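(* Let $G=\mathbb Z^d$ with $d\geq1$, and let $A$ be a finite alphabet. Let $X\subset A^G$ be a strongly irreducible closed subshift of finite type which contains a periodic configuration. Suppose that $\tau\colon X\to X$ is a cellular automaton such that $\tau|_U$ is injective for some nonempty open subset $U\subset X$. Then $\tau$ is surjective and pre-injective.
   Context: $A^G$ is the set of all maps $x\colon G\to A$ with the prodiscrete topology (product of discrete topologies) and shift action $(gx)(h)=x(g^{-1}h)$ (group operation of $G$ written multiplicatively); $X\subset A^G$ has the subspace topology. A subshift is a $G$-invariant subset of $A^G$. A subshift $X$ is of finite type if there are a finite $D\subset G$ and $\mathcal P\subset A^D$ such that $X=\{x\in A^G:(gx)|_D\in\mathcal P\text{ for all }g\in G\}$. A subshift $X$ is strongly irreducible if there is a finite $\Delta\subset G$ such that for all $x,y\in X$ and finite $S,T\subset G$ with $S\Delta\cap T=\varnothing$ there exists $z\in X$ with $z|_S=x|_S$ and $z|_T=y|_T$. A configuration $x$ is periodic if its orbit under $G$ is finite (equivalently, it is fixed by $m\mathbb Z^d$ for some integer $m\geq1$). A cellular automaton $\tau\colon X\to X$ is a continuous $G$-equivariant map; equivalently there are a finite $M\subset G$ and a map $\mu\colon A^M\to A$ with $\tau(x)(g)=\mu((g^{-1}x)|_M)$ for all $x\in X$, $g\in G$. $\tau$ is pre-injective if for all $x,y\in X$ that coincide outside a finite subset of $G$, $\tau(x)=\tau(y)$ implies $x=y$. *)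

theory Defs
  imports "HOL-Analysis.Analysis"
begin

text \<open>
  Configurations over a group \<open>G\<close> and an alphabet \<open>A\<close> are functions \<open>'g \<Rightarrow> 'a\<close>.  The group is
  written additively but not assumed commutative: \<open>- g + h\<close> stands for \<open>g\<^sup>-\<^sup>1h\<close>.
\<close>

definition shift :: "'g::group_add \<Rightarrow> ('g \<Rightarrow> 'a) \<Rightarrow> ('g \<Rightarrow> 'a)" where
  "shift g x = (\<lambda>h. x (- g + h))"

definition prodiscrete :: "('g \<Rightarrow> 'a) topology" where
  "prodiscrete = product_topology (\<lambda>_. discrete_topology UNIV) UNIV"

definition subshift :: "('g::group_add \<Rightarrow> 'a) set \<Rightarrow> bool" where
  "subshift X \<longleftrightarrow> (\<forall>g. \<forall>x\<in>X. shift g x \<in> X)"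

text \<open>Patterns, i.e. elements of \<open>A\<^sup>D\<close>, are the functions that are extensional on \<open>D\<close>.\<close>

definition finite_type :: "('g::group_add \<Rightarrow> 'a) set \<Rightarrow> bool" where
  "finite_type X \<longleftrightarrow>
     (\<exists>D P. finite D \<and> P \<subseteq> (D \<rightarrow>\<^sub>E UNIV) \<and> X = {x. \<forall>g. restrict (shift g x) D \<in> P})"

definition strongly_irreducible :: "('g::group_add \<Rightarrow> 'a) set \<Rightarrow> bool" where
  "strongly_irreducible X \<longleftrightarrow>
     (\<exists>\<Delta>. finite \<Delta> \<and>
       (\<forall>x\<in>X. \<forall>y\<in>X. \<forall>S T. finite S \<and> finite T \<and> {s + t | s t. s \<in> S \<and> t \<in> \<Delta>} \<inter> T = {} \<longrightarrow>
         (\<exists>z\<in>X. restrict z S = restrict x S \<and> restrict z T = restrict y T)))"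

definition periodic :: "('g::group_add \<Rightarrow> 'a) \<Rightarrow> bool" where
  "periodic x \<longleftrightarrow> finite (range (\<lambda>g. shift g x))"

text \<open>
  A map on \<open>X\<close> is represented by a function on all configurations, whose values outside \<open>X\<close> are
  irrelevant; continuity between subspaces includes that \<open>X\<close> is mapped into \<open>X\<close>.
\<close>

definition cellular_automaton ::
  "('g::group_add \<Rightarrow> 'a) set \<Rightarrow> (('g \<Rightarrow> 'a) \<Rightarrow> ('g \<Rightarrow> 'a)) \<Rightarrow> bool" where
  "cellular_automaton X \<tau> \<longleftrightarrow>
     continuous_map (subtopology prodiscrete X) (subtopology prodiscrete X) \<tau> \<and>
     (\<forall>g. \<forall>x\<in>X. \<tau> (shift g x) = shift g (\<tau> x))"

definition pre_injective :: "('g \<Rightarrow> 'a) set \<Rightarrow> (('g \<Rightarrow> 'a) \<Rightarrow> ('g \<Rightarrow> 'a)) \<Rightarrow> bool" where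
  "pre_injective X \<tau> \<longleftrightarrow>
     (\<forall>x\<in>X. \<forall>y\<in>X. finite {g. x g \<noteq> y g} \<and> \<tau> x = \<tau> y \<longrightarrow> x = y)"

end

theory Submission imports Defs begin

text \<open>
  A pair of distinct almost equal configurations with the same image could be planted, by strong
  irreducibility and finite type, in a member of the open set without leaving it, so local
  injectivity forces pre-injectivity.  Surjectivity then follows by counting patterns on large boxes
  \<open>B\<close>: if some pattern of \<open>X\<close> does not occur in \<open>\<tau> ` X\<close>, then \<open>\<tau> ` X\<close> has fewer patterns on \<open>B\<close>
  than \<open>X\<close>, by a factor exponential in the volume of \<open>B\<close>; pre-injectivity only allows a factor
  exponential in its boundary.
\<close>

section \<open>Compactness\<close>

lemma topspace_prodiscrete [simp]: "topspace prodiscrete = UNIV"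
  by (simp add: prodiscrete_def)

text \<open>Tychonoff: a finite discrete alphabet is compact, hence so is the full configuration
  space.\<close>

lemma compactin_prodiscrete:
  fixes X :: "('g \<Rightarrow> 'a::finite) set"
  assumes "closedin prodiscrete X"
  shows "compactin prodiscrete X"
proof -
  have "compact_space (prodiscrete :: ('g \<Rightarrow> 'a) topology)"
    unfolding prodiscrete_def compact_space_product_topology
    by (auto simp: compact_space_discrete_topology)
  then show ?thesis
    using assms closedin_compact_space by blast
qed

lemma openin_cylinder:
  assumes "finite F"
  shows "openin prodiscrete {x. \<forall>g\<in>F. x g = p g}"
proof -
  have "openin prodiscrete {x. x g = p g}" for g
  proof -
    have "continuous_map prodiscrete (discrete_topology UNIV) (\<lambda>x. x g)"
      unfolding prodiscrete_def by (rule continuous_map_product_projection) simp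
    then have "openin prodiscrete {x \<in> topspace prodiscrete. x g \<in> {p g}}"
      by (rule openin_continuous_map_preimage) simp
    then show ?thesis by simp
  qed
  moreover have "{x. \<forall>g\<in>F. x g = p g} = \<Inter>((\<lambda>g. {x. x g = p g}) ` F) \<inter> topspace prodiscrete"
    by auto
  ultimately show ?thesis
    using assms by (metis (no_types, lifting) openin_INT openin_topspace Int_commute)
qed

lemma closedin_eval:
  "closedin prodiscrete {x. x g = a}"
proof -
  have "continuous_map prodiscrete (discrete_topology UNIV) (\<lambda>x. x g)"
    unfolding prodiscrete_def by (rule continuous_map_product_projection) simp
  then have "closedin prodiscrete {x \<in> topspace prodiscrete. x g \<in> {a}}"
    by (rule closedin_continuous_map_preimage) simp
  then show ?thesis by simp
qed

lemma openin_prodiscrete_cylinder: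
  assumes "openin prodiscrete U" "p \<in> U"
  obtains F where "finite F" "{x. \<forall>g\<in>F. x g = p g} \<subseteq> U"
proof -
  obtain V where V: "finite {i. V i \<noteq> UNIV}" "p \<in> Pi\<^sub>E UNIV V" "Pi\<^sub>E UNIV V \<subseteq> U"
    using assms unfolding prodiscrete_def openin_product_topology_alt by auto
  have "{x. \<forall>g\<in>{i. V i \<noteq> UNIV}. x g = p g} \<subseteq> Pi\<^sub>E UNIV V"
  proof
    fix x assume "x \<in> {x. \<forall>g\<in>{i. V i \<noteq> UNIV}. x g = p g}"
    then have "x g \<in> V g" for g
      using V(2) by (cases "V g = UNIV") (auto simp: PiE_iff)
    then show "x \<in> Pi\<^sub>E UNIV V" by (auto simp: PiE_iff)
  qed
  then show thesis using V(1,3) by (intro that[of "{i. V i \<noteq> UNIV}"]) auto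
qed

section \<open>Local rules and images of cellular automata\<close>

text \<open>One half of the Curtis-Hedlund-Lyndon theorem: continuity gives each \<open>x\<close> a
  finite window deciding the value at 0, compactness makes the window uniform, and equivariance
  carries it to every \<open>g\<close>.\<close>

lemma cellular_automaton_local:
  fixes X :: "('g::group_add \<Rightarrow> 'a::finite) set"
  assumes X: "subshift X" "closedin prodiscrete X" and ca: "cellular_automaton X \<tau>"
  obtains M where "finite M"
    "\<And>x y g. x \<in> X \<Longrightarrow> y \<in> X \<Longrightarrow> (\<And>m. m \<in> M \<Longrightarrow> x (g + m) = y (g + m)) \<Longrightarrow> \<tau> x g = \<tau> y g"
proof -
  have "\<exists>F. finite F \<and> (\<forall>y\<in>X. (\<forall>g\<in>F. y g = x g) \<longrightarrow> \<tau> y 0 = \<tau> x 0)" if "x \<in> X" for x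
  proof -
    have "openin (subtopology prodiscrete X) (X \<inter> {y. \<forall>g\<in>{0}. y g = \<tau> x g})"
      by (rule openin_subtopology_Int2) (rule openin_cylinder, simp)
    then have "openin (subtopology prodiscrete X)
        {y \<in> topspace (subtopology prodiscrete X). \<tau> y \<in> X \<inter> {y. \<forall>g\<in>{0}. y g = \<tau> x g}}"
      using ca unfolding cellular_automaton_def by (blast intro: openin_continuous_map_preimage)
    then obtain T where T: "openin prodiscrete T"
      "{y \<in> X. \<tau> y \<in> X \<and> \<tau> y 0 = \<tau> x 0} = T \<inter> X"
      by (auto simp: openin_subtopology)
    have "\<tau> x \<in> X"
      using ca that unfolding cellular_automaton_def continuous_map_def by auto
    then have "x \<in> T" using T(2) that by blast
    then obtain F where "finite F" "{y. \<forall>g\<in>F. y g = x g} \<subseteq> T"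
      by (rule openin_prodiscrete_cylinder[OF T(1)])
    then show ?thesis using T(2) by blast
  qed
  then obtain F where F: "\<And>x. x \<in> X \<Longrightarrow> finite (F x)"
    "\<And>x y. x \<in> X \<Longrightarrow> y \<in> X \<Longrightarrow> (\<forall>g\<in>F x. y g = x g) \<Longrightarrow> \<tau> y 0 = \<tau> x 0"
    by metis
  have "compactin prodiscrete X" using X(2) by (rule compactin_prodiscrete)
  moreover have "openin prodiscrete U" if "U \<in> (\<lambda>x. {y. \<forall>g\<in>F x. y g = x g}) ` X" for U
    using that F(1) openin_cylinder by auto
  moreover have "X \<subseteq> \<Union>((\<lambda>x. {y. \<forall>g\<in>F x. y g = x g}) ` X)" by auto
  ultimately have "\<exists>\<F>. finite \<F> \<and> \<F> \<subseteq> (\<lambda>x. {y. \<forall>g\<in>F x. y g = x g}) ` X \<and> X \<subseteq> \<Union>\<F>"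
    by (rule compactinD)
  then obtain \<F> where \<F>: "finite \<F>" "\<F> \<subseteq> (\<lambda>x. {y. \<forall>g\<in>F x. y g = x g}) ` X" "X \<subseteq> \<Union>\<F>"
    by blast
  then obtain C where C: "finite C" "C \<subseteq> X" "X \<subseteq> (\<Union>x\<in>C. {y. \<forall>g\<in>F x. y g = x g})"
    using finite_subset_image[OF \<F>(1,2)] by blast
  have loc: "\<tau> x 0 = \<tau> y 0" if xy: "x \<in> X" "y \<in> X" and eq: "\<And>m. m \<in> \<Union>(F ` C) \<Longrightarrow> x m = y m" for x y
  proof -
    obtain c where c: "c \<in> C" "\<forall>g\<in>F c. x g = c g" using C(3) xy(1) by blast
    have "\<forall>g\<in>F c. y g = c g" using c eq by (metis UN_I)
    then show ?thesis using F(2) c C(2) xy by (metis subsetD)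
  qed
  show thesis
  proof
    show "finite (\<Union>(F ` C))" using C F(1) by auto
    fix x y g assume xy: "x \<in> X" "y \<in> X" and eq: "\<And>m. m \<in> \<Union>(F ` C) \<Longrightarrow> x (g + m) = y (g + m)"
    have "shift (- g) x \<in> X" "shift (- g) y \<in> X" using X(1) xy by (auto simp: subshift_def)
    then have "\<tau> (shift (- g) x) 0 = \<tau> (shift (- g) y) 0"
      by (rule loc) (simp add: shift_def eq)
    moreover have "\<tau> (shift (- g) u) 0 = \<tau> u g" if "u \<in> X" for u
    proof -
      have "\<tau> (shift (- g) u) = shift (- g) (\<tau> u)"
        using ca that by (simp add: cellular_automaton_def)
      then show ?thesis by (simp add: shift_def)
    qed
    ultimately show "\<tau> x g = \<tau> y g" using xy by simp
  qed
qed

text \<open>Compact sets are closed in a Hausdorff space. Closedness makes a point missing from the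
  image detectable on finitely many coordinates.\<close>

lemma closedin_image_cellular_automaton:
  fixes X :: "('g::group_add \<Rightarrow> 'a::finite) set"
  assumes "closedin prodiscrete X" "cellular_automaton X \<tau>"
  shows "closedin prodiscrete (\<tau> ` X)"
proof -
  have "compactin (subtopology prodiscrete X) X"
    using compactin_prodiscrete[OF assms(1)] by (simp add: compactin_subtopology)
  then have "compactin (subtopology prodiscrete X) (\<tau> ` X)"
    using assms(2) unfolding cellular_automaton_def by (blast intro: image_compactin)
  then have "compactin prodiscrete (\<tau> ` X)" by (simp add: compactin_subtopology)
  moreover have "Hausdorff_space (prodiscrete :: ('g \<Rightarrow> 'a) topology)"
    unfolding prodiscrete_def Hausdorff_space_product_topology by simp
  ultimately show ?thesis by (blast intro: compactin_imp_closedin)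
qed

text \<open>By compactness, the second configuration can be prescribed on an infinite set.\<close>

lemma strongly_irreducible_gluing:
  fixes X :: "('g::group_add \<Rightarrow> 'a::finite) set"
  assumes cl: "closedin prodiscrete X" and si: "strongly_irreducible X"
  obtains \<Delta> where "finite \<Delta>" "0 \<in> \<Delta>"
    "\<And>x y S. x \<in> X \<Longrightarrow> y \<in> X \<Longrightarrow> finite S \<Longrightarrow>
      \<exists>z\<in>X. (\<forall>s\<in>S. z s = x s) \<and> (\<forall>t. t \<notin> S + \<Delta> \<longrightarrow> z t = y t)"
proof -
  obtain \<Delta>' where \<Delta>': "finite \<Delta>' \<and> (\<forall>x\<in>X. \<forall>y\<in>X. \<forall>S T. finite S \<and> finite T \<and>
      {s + t | s t. s \<in> S \<and> t \<in> \<Delta>'} \<inter> T = {} \<longrightarrow>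
      (\<exists>z\<in>X. restrict z S = restrict x S \<and> restrict z T = restrict y T))"
    using si unfolding strongly_irreducible_def by (rule exE)
  \<comment> \<open>Enlarging \<open>\<Delta>'\<close> only shrinks the set on which
    \<open>y\<close> is prescribed; with 0 included, \<open>S\<close> lies inside
    \<open>S + \<Delta>\<close>.\<close>
  define \<Delta> where "\<Delta> = insert 0 \<Delta>'"
  show thesis
  proof
    show "finite \<Delta>" "0 \<in> \<Delta>" using \<Delta>' by (auto simp: \<Delta>_def)
    fix x y :: "'g \<Rightarrow> 'a" and S :: "'g set"
    assume x: "x \<in> X" and y: "y \<in> X" and S: "finite S"
    \<comment> \<open>Each prescribed value is a closed condition, so the finite intersection
      property reduces the claim to finitely many conditions, where strong irreducibility
      applies.\<close>
    define Z where "Z = (\<lambda>s. {z. z s = x s}) ` S \<union> (\<lambda>t. {z. z t = y t}) ` (- (S + \<Delta>))"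
    have "X \<inter> \<Inter>Z \<noteq> {}"
    proof (rule ccontr)
      assume "\<not> X \<inter> \<Inter>Z \<noteq> {}"
      moreover have "\<forall>C\<in>Z. closedin prodiscrete C"
        by (auto simp: Z_def closedin_eval)
      ultimately obtain \<F> where \<F>: "finite \<F>" "\<F> \<subseteq> Z" "X \<inter> \<Inter>\<F> = {}"
        using compactin_prodiscrete[OF cl] unfolding compactin_fip by metis
      obtain F1 F2 where F12: "\<F> = F1 \<union> F2" "F1 \<subseteq> (\<lambda>s. {z. z s = x s}) ` S"
        "F2 \<subseteq> (\<lambda>t. {z. z t = y t}) ` (- (S + \<Delta>))"
        using \<F>(2) unfolding Z_def by (rule subset_UnE)
      have "finite F2" using \<F>(1) F12(1) by simp
      then obtain T where T: "T \<subseteq> - (S + \<Delta>)" "finite T" "F2 = (\<lambda>t. {z. z t = y t}) ` T"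
        using finite_subset_image[OF _ F12(3)] by blast
      have "{s + t | s t. s \<in> S \<and> t \<in> \<Delta>'} \<inter> T = {}"
        using T(1) by (fastforce simp: \<Delta>_def set_plus_def)
      then have "\<exists>z\<in>X. restrict z S = restrict x S \<and> restrict z T = restrict y T"
        using S T(2) by (intro \<Delta>'[THEN conjunct2, rule_format] x y conjI)
      then obtain z where z: "z \<in> X" "restrict z S = restrict x S" "restrict z T = restrict y T"
        by blast
      have eq: "\<forall>s\<in>S. z s = x s" "\<forall>t\<in>T. z t = y t" using z by (metis restrict_apply')+
      have "\<forall>C\<in>F1. z \<in> C" using F12(2) eq(1) by blast
      moreover have "\<forall>C\<in>F2. z \<in> C" using T(3) eq(2) by simp
      ultimately have "z \<in> \<Inter>\<F>" using F12(1) by blast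
      then show False using z(1) \<F>(3) by blast
    qed
    then show "\<exists>z\<in>X. (\<forall>s\<in>S. z s = x s) \<and> (\<forall>t. t \<notin> S + \<Delta> \<longrightarrow> z t = y t)"
      by (auto simp: Z_def)
  qed
qed

section \<open>Local injectivity implies pre-injectivity\<close>

text \<open>The allowed patterns are replaced by patterns that occur in \<open>X\<close>. In this
  form, a configuration made by cutting and pasting can be certified window by window.\<close>

lemma finite_type_local:
  fixes X :: "('g::group_add \<Rightarrow> 'a) set"
  assumes "finite_type X"
  obtains D where "finite D"
    "\<And>x. (\<And>g. \<exists>y\<in>X. \<forall>d\<in>D. x (g + d) = y (g + d)) \<Longrightarrow> x \<in> X"
proof -
  obtain D P where D: "finite D" and X: "X = {x. \<forall>g. restrict (shift g x) D \<in> P}"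
    using assms unfolding finite_type_def by auto
  show thesis
  proof
    show "finite D" by fact
    fix x assume loc: "\<And>g. \<exists>y\<in>X. \<forall>d\<in>D. x (g + d) = y (g + d)"
    have "restrict (shift g x) D \<in> P" for g
    proof -
      obtain y where "y \<in> X" "\<forall>d\<in>D. x (- g + d) = y (- g + d)" using loc by blast
      then have "restrict (shift g x) D = restrict (shift g y) D"
        by (intro restrict_ext) (auto simp: shift_def)
      then show ?thesis using \<open>y \<in> X\<close> X by auto
    qed
    then show "x \<in> X" using X by auto
  qed
qed

lemma locally_injective_imp_pre_injective:
  fixes X :: "('g::group_add \<Rightarrow> 'a::finite) set"
  assumes inf: "infinite (UNIV :: 'g set)"
    and X: "subshift X" "closedin prodiscrete X" "strongly_irreducible X" "finite_type X"
    and ca: "cellular_automaton X \<tau>"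
    and U: "openin (subtopology prodiscrete X) U" "U \<noteq> {}" "inj_on \<tau> U"
  shows "pre_injective X \<tau>"
  unfolding pre_injective_def
proof (intro ballI impI)
  fix x y assume x: "x \<in> X" and y: "y \<in> X" and xy: "finite {g. x g \<noteq> y g} \<and> \<tau> x = \<tau> y"
  define \<Omega> where "\<Omega> = {g. x g \<noteq> y g}"
  obtain \<Delta> where \<Delta>: "finite \<Delta>" "0 \<in> \<Delta>"
    "\<And>x y S. x \<in> X \<Longrightarrow> y \<in> X \<Longrightarrow> finite S \<Longrightarrow>
      \<exists>z\<in>X. (\<forall>s\<in>S. z s = x s) \<and> (\<forall>t. t \<notin> S + \<Delta> \<longrightarrow> z t = y t)"
    using strongly_irreducible_gluing[OF X(2,3)] by blast
  obtain D where D: "finite D"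
    "\<And>x. (\<And>g. \<exists>y\<in>X. \<forall>d\<in>D. x (g + d) = y (g + d)) \<Longrightarrow> x \<in> X"
    using finite_type_local[OF X(4)] by blast
  obtain M where M: "finite M"
    "\<And>x y g. x \<in> X \<Longrightarrow> y \<in> X \<Longrightarrow> (\<And>m. m \<in> M \<Longrightarrow> x (g + m) = y (g + m)) \<Longrightarrow> \<tau> x g = \<tau> y g"
    using cellular_automaton_local[OF X(1,2) ca] by metis
  obtain V where V: "openin prodiscrete V" "U = V \<inter> X"
    using U(1) by (auto simp: openin_subtopology)
  obtain p where p: "p \<in> U" using U(2) by blast
  then have "p \<in> V" using V(2) by simp
  then obtain F where F: "finite F" "{z. \<forall>g\<in>F. z g = p g} \<subseteq> V"
    by (rule openin_prodiscrete_cylinder[OF V(1)])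
  \<comment> \<open>One window serves both membership in \<open>X\<close> and the local rule. Since
    \<open>k + w' = (k + w) + (- w + w')\<close>, the set \<open>\<Omega>'\<close> contains every
    point that shares a window \<open>k + W\<close> with a point of \<open>\<Omega>\<close>.\<close>
  define W where "W = insert 0 (D \<union> M)"
  define \<Omega>' where "\<Omega>' = \<Omega> + (\<lambda>(a, b). - a + b) ` (W \<times> W)"
  have "finite \<Omega>'"
    using xy D(1) M(1) unfolding \<Omega>'_def \<Omega>_def W_def by (intro finite_set_plus) auto
  then have "finite ((F + \<Delta>) + uminus ` \<Omega>')"
    using F(1) \<Delta>(1) by (intro finite_set_plus) auto
  \<comment> \<open>The infinite group leaves room for a \<open>g\<close> whose translate
    \<open>g + \<Omega>'\<close> misses \<open>F + \<Delta>\<close>.\<close>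
  then obtain g where g: "g \<notin> (F + \<Delta>) + uminus ` \<Omega>'"
    using inf by (metis UNIV_I finite_subset subsetI)
  have far: "g + w \<notin> F + \<Delta>" if "w \<in> \<Omega>'" for w
  proof
    assume "g + w \<in> F + \<Delta>"
    then have "(g + w) + - w \<in> (F + \<Delta>) + uminus ` \<Omega>'" using that by (rule set_plus_intro[OF _ imageI])
    moreover have "(g + w) + - w = g" by (simp add: add.assoc)
    ultimately show False using g by metis
  qed
  have shift_X: "shift g u \<in> X" if "u \<in> X" for u
    using X(1) that by (simp add: subshift_def)
  have "p \<in> X" using p V(2) by simp
  then obtain z where z: "z \<in> X" "\<forall>s\<in>F. z s = p s" "\<forall>t. t \<notin> F + \<Delta> \<longrightarrow> z t = shift g x t"
    using \<Delta>(3) shift_X[OF x] F(1) by metis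
  \<comment> \<open>\<open>z\<close> carries the shifted \<open>x\<close> on all of
    \<open>g + \<Omega>'\<close>; \<open>z'\<close> swaps in the shifted \<open>y\<close> exactly
    where the two shifted configurations differ.\<close>
  define z' where "z' h = (if - g + h \<in> \<Omega> then shift g y h else z h)" for h
  have near: "z' (k + w') = shift g y (k + w') \<and> z (k + w') = shift g x (k + w')"
    if w: "w \<in> W" "- g + (k + w) \<in> \<Omega>" "w' \<in> W" for k w w'
  proof -
    have "(- g + (k + w)) + (- w + w') \<in> \<Omega>'"
      unfolding \<Omega>'_def using w by (intro set_plus_intro) auto
    moreover have "g + ((- g + (k + w)) + (- w + w')) = k + w'" by (simp add: add.assoc)
    ultimately have "k + w' \<notin> F + \<Delta>" using far by metis
    then have "z (k + w') = shift g x (k + w')" using z(3) by blast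
    then show ?thesis by (auto simp: z'_def shift_def \<Omega>_def)
  qed
  \<comment> \<open>A window either misses the swapped region or lies in
    \<open>g + \<Omega>'\<close>, where both configurations look like the shifted originals. This
    yields \<open>z' \<in> X\<close> through \<open>D\<close> and equal images through
    \<open>M\<close>.\<close>
  have window: "(\<forall>w\<in>W. z' (k + w) = z (k + w)) \<or>
      (\<forall>w\<in>W. z' (k + w) = shift g y (k + w) \<and> z (k + w) = shift g x (k + w))" for k
  proof (cases "\<exists>w\<in>W. - g + (k + w) \<in> \<Omega>")
    case True
    then show ?thesis using near by blast
  next
    case False
    then show ?thesis by (simp add: z'_def)
  qed
  have z'X: "z' \<in> X"
  proof (rule D(2))
    fix k
    show "\<exists>u\<in>X. \<forall>d\<in>D. z' (k + d) = u (k + d)"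
      using window[of k] z(1) shift_X[OF y] unfolding W_def by blast
  qed
  have "\<tau> z = \<tau> z'"
  proof
    fix k
    show "\<tau> z k = \<tau> z' k"
      using window[of k]
    proof
      assume "\<forall>w\<in>W. z' (k + w) = z (k + w)"
      then show ?thesis using z(1) z'X by (intro M(2)) (auto simp: W_def)
    next
      assume *: "\<forall>w\<in>W. z' (k + w) = shift g y (k + w) \<and> z (k + w) = shift g x (k + w)"
      have "\<tau> z k = \<tau> (shift g x) k"
        using * z(1) shift_X[OF x] by (intro M(2)) (auto simp: W_def)
      also have "\<dots> = \<tau> (shift g y) k"
        using ca x y xy unfolding cellular_automaton_def by simp
      also have "\<dots> = \<tau> z' k"
        using * z'X shift_X[OF y] by (intro M(2)) (auto simp: W_def)
      finally show ?thesis .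
    qed
  qed
  \<comment> \<open>The swap leaves \<open>F\<close> untouched, so \<open>z'\<close> stays in the
    cylinder around \<open>p\<close>, just like \<open>z\<close>.\<close>
  have off: "- g + h \<notin> \<Omega>" if "h \<in> F" for h
  proof
    assume "- g + h \<in> \<Omega>"
    moreover have "0 \<in> (\<lambda>(a, b). - a + b) ` (W \<times> W)" by (force simp: W_def)
    ultimately have "(- g + h) + 0 \<in> \<Omega>'" unfolding \<Omega>'_def by (rule set_plus_intro)
    then have "g + (- g + h + 0) \<notin> F + \<Delta>" by (rule far)
    moreover have "h + 0 \<in> F + \<Delta>" using that \<Delta>(2) by (rule set_plus_intro)
    ultimately show False by simp
  qed
  have "z \<in> U" using z(1,2) F(2) V(2) by blast
  moreover have "z' \<in> U" using z'X z(2) off F(2) V(2) by (auto simp: z'_def)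
  ultimately have "z = z'" using U(3) \<open>\<tau> z = \<tau> z'\<close> by (auto dest: inj_onD)
  show "x = y"
  proof (rule ccontr)
    assume "x \<noteq> y"
    then obtain w where w: "w \<in> \<Omega>" by (auto simp: \<Omega>_def fun_eq_iff)
    have "- g + ((g + w) + 0) \<in> \<Omega>" using w by (simp add: add.assoc)
    then have "z' (g + w + 0) = shift g y (g + w + 0) \<and> z (g + w + 0) = shift g x (g + w + 0)"
      by (intro near[of 0]) (auto simp: W_def)
    then show False using \<open>z = z'\<close> w by (simp add: shift_def \<Omega>_def add.assoc) metis
  qed
qed

section \<open>Counting patterns\<close>

text \<open>Patterns remain total functions, \<open>undefined\<close> off \<open>B\<close>, so that
  they can be compared at any point.\<close>

definition patterns :: "('g \<Rightarrow> 'a) set \<Rightarrow> 'g set \<Rightarrow> ('g \<Rightarrow> 'a) set" where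
  "patterns X B = (\<lambda>x. restrict x B) ` X"

lemma finite_patterns:
  fixes X :: "('g \<Rightarrow> 'a::finite) set"
  assumes "finite B"
  shows "finite (patterns X B)"
proof -
  have "patterns X B \<subseteq> B \<rightarrow>\<^sub>E UNIV" by (auto simp: patterns_def)
  then show ?thesis by (rule finite_subset) (simp add: assms finite_PiE)
qed

text \<open>A pattern on \<open>C\<close> splits into its part on \<open>B\<close> and at most
  arbitrary letters on \<open>C - B\<close>: the price of a boundary layer.\<close>

lemma card_patterns_mono:
  fixes Y :: "('g \<Rightarrow> 'a::finite) set"
  assumes "finite C" "B \<subseteq> C"
  shows "card (patterns Y C) \<le> card (patterns Y B) * CARD('a) ^ card (C - B)"
proof -
  have fin: "finite B" "finite (C - B)" using assms finite_subset by auto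
  have "card (patterns Y C) \<le> card (patterns Y B \<times> ((C - B) \<rightarrow>\<^sub>E (UNIV :: 'a set)))"
  proof (rule card_inj_on_le)
    show "inj_on (\<lambda>w. (restrict w B, restrict w (C - B))) (patterns Y C)"
    proof (rule inj_onI)
      fix w w' assume w: "w \<in> patterns Y C" "w' \<in> patterns Y C"
        and eq: "(restrict w B, restrict w (C - B)) = (restrict w' B, restrict w' (C - B))"
      show "w = w'"
      proof
        fix g show "w g = w' g"
        proof (cases "g \<in> C")
          case True
          then show ?thesis using eq by (metis Diff_iff Pair_inject restrict_apply')
        next
          case False
          then show ?thesis using w by (auto simp: patterns_def)
        qed
      qed
    qed
    show "(\<lambda>w. (restrict w B, restrict w (C - B))) ` patterns Y C
        \<subseteq> patterns Y B \<times> ((C - B) \<rightarrow>\<^sub>E (UNIV :: 'a set))"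
    proof -
      have "restrict w B \<in> patterns Y B" if "w \<in> patterns Y C" for w
        using that assms(2) by (auto simp: patterns_def Int_absorb1)
      then show ?thesis by (auto split: if_splits)
    qed
    show "finite (patterns Y B \<times> ((C - B) \<rightarrow>\<^sub>E (UNIV :: 'a set)))"
      using fin by (simp add: finite_patterns finite_PiE)
  qed
  then show ?thesis by (simp add: card_cartesian_product card_PiE[OF fin(2)])
qed

text \<open>
  Each pattern on \<open>B\<close> extends to a configuration equal to a fixed one outside \<open>B + \<Delta>\<close>; the images of
  these extensions are distinct, and determined by their values on a neighbourhood \<open>C\<close> of \<open>B\<close>.
\<close>

lemma pre_injective_card_patterns_le:
  fixes X :: "('g::group_add \<Rightarrow> 'a::finite) set"
  assumes pre: "pre_injective X \<tau>"
    and \<Delta>: "finite \<Delta>" "\<And>x y S. x \<in> X \<Longrightarrow> y \<in> X \<Longrightarrow> finite S \<Longrightarrow>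
      \<exists>z\<in>X. (\<forall>s\<in>S. z s = x s) \<and> (\<forall>t. t \<notin> S + \<Delta> \<longrightarrow> z t = y t)"
    and M: "\<And>x y g. x \<in> X \<Longrightarrow> y \<in> X \<Longrightarrow> (\<And>m. m \<in> M \<Longrightarrow> x (g + m) = y (g + m)) \<Longrightarrow> \<tau> x g = \<tau> y g"
    and B: "finite B" and C: "finite C" "B + \<Delta> + uminus ` M \<subseteq> C"
  shows "card (patterns X B) \<le> card (patterns (\<tau> ` X) C)"
proof (cases "X = {}")
  case True
  then show ?thesis by (simp add: patterns_def)
next
  case False
  then obtain y where y: "y \<in> X" by blast
  have "\<exists>z\<in>X. restrict z B = w \<and> (\<forall>t. t \<notin> B + \<Delta> \<longrightarrow> z t = y t)" if w: "w \<in> patterns X B" for w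
  proof -
    obtain x where x: "x \<in> X" "w = restrict x B" using w unfolding patterns_def by blast
    obtain z where "z \<in> X" "\<forall>s\<in>B. z s = x s" "\<forall>t. t \<notin> B + \<Delta> \<longrightarrow> z t = y t"
      using \<Delta>(2)[OF x(1) y B] by blast
    then show ?thesis using x(2) by (intro bexI[of _ z]) (auto simp: restrict_def)
  qed
  then obtain z where z: "\<And>w. w \<in> patterns X B \<Longrightarrow> z w \<in> X"
    "\<And>w. w \<in> patterns X B \<Longrightarrow> restrict (z w) B = w"
    "\<And>w t. w \<in> patterns X B \<Longrightarrow> t \<notin> B + \<Delta> \<Longrightarrow> z w t = y t"
    by metis
  \<comment> \<open>For \<open>k\<close> outside \<open>C\<close> the window \<open>k + M\<close>
    misses \<open>B + \<Delta>\<close>, so the local rule sees only the background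
    \<open>y\<close>.\<close>
  have out: "\<tau> (z w) k = \<tau> y k" if w: "w \<in> patterns X B" and k: "k \<notin> C" for w k
  proof (rule M)
    show "z w \<in> X" "y \<in> X" using z(1) w y by auto
    fix m assume m: "m \<in> M"
    have "k + m \<notin> B + \<Delta>"
    proof
      assume "k + m \<in> B + \<Delta>"
      then have "(k + m) + - m \<in> B + \<Delta> + uminus ` M" using m by (rule set_plus_intro[OF _ imageI])
      moreover have "(k + m) + - m = k" by (simp add: add.assoc)
      ultimately show False using k C(2) by auto
    qed
    then show "z w (k + m) = y (k + m)" using z(3) w by blast
  qed
  show ?thesis
  proof (rule card_inj_on_le)
    show "(\<lambda>w. restrict (\<tau> (z w)) C) ` patterns X B \<subseteq> patterns (\<tau> ` X) C"
      using z(1) by (auto simp: patterns_def)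
    show "finite (patterns (\<tau> ` X) C)" using C(1) by (rule finite_patterns)
    show "inj_on (\<lambda>w. restrict (\<tau> (z w)) C) (patterns X B)"
    proof (rule inj_onI)
      fix w w' assume w: "w \<in> patterns X B" "w' \<in> patterns X B"
        and eq: "restrict (\<tau> (z w)) C = restrict (\<tau> (z w')) C"
      have "\<tau> (z w) k = \<tau> (z w') k" for k
      proof (cases "k \<in> C")
        case True
        then show ?thesis using eq by (metis restrict_apply')
      next
        case False
        then show ?thesis using out w by simp
      qed
      moreover have "finite {g. z w g \<noteq> z w' g}"
      proof (rule finite_subset)
        show "{g. z w g \<noteq> z w' g} \<subseteq> B + \<Delta>" using z(3)[OF w(1)] z(3)[OF w(2)] by (metis (mono_tags, lifting) mem_Collect_eq subsetI)
        show "finite (B + \<Delta>)" using B \<Delta>(1) by (rule finite_set_plus)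
      qed
      ultimately have "z w = z w'"
        using pre z(1) w unfolding pre_injective_def by blast
      then show "w = w'" using z(2) w by metis
    qed
  qed
qed

text \<open>
  Overwriting a translate \<open>g + E\<close> by the pattern of \<open>p\<close> maps the patterns that avoid it at all
  places of \<open>J\<close> to those that avoid it at \<open>J\<close> but not at \<open>g\<close>, and only the values on \<open>g + (E + \<Delta>)\<close>
  are lost.  So forbidding each further place costs a factor \<open>1 - 1 / K\<close>.
\<close>

lemma card_patterns_avoiding:
  fixes X :: "('g::group_add \<Rightarrow> 'a::finite) set"
  assumes X: "subshift X"
    and \<Delta>: "finite \<Delta>" "0 \<in> \<Delta>" "\<And>x y S. x \<in> X \<Longrightarrow> y \<in> X \<Longrightarrow> finite S \<Longrightarrow>
      \<exists>z\<in>X. (\<forall>s\<in>S. z s = x s) \<and> (\<forall>t. t \<notin> S + \<Delta> \<longrightarrow> z t = y t)"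
    and p: "p \<in> X" and E: "finite E" and B: "finite B"
    and J: "finite J" "\<And>g. g \<in> J \<Longrightarrow> (+) g ` (E + \<Delta>) \<subseteq> B"
      "disjoint_family_on (\<lambda>g. (+) g ` (E + \<Delta>)) J"
    and K: "K = CARD('a) ^ card (E + \<Delta>)"
  shows "K ^ card J * card (patterns {x\<in>X. \<forall>g\<in>J. \<exists>e\<in>E. x (g + e) \<noteq> p e} B)
    \<le> (K - 1) ^ card J * card (patterns X B)"
  using J
proof (induction J)
  case empty
  then show ?case by simp
next
  case (insert g J)
  define W where "W = patterns {x\<in>X. \<forall>g\<in>J. \<exists>e\<in>E. x (g + e) \<noteq> p e} B"
  define W' where "W' = patterns {x\<in>X. \<forall>g\<in>insert g J. \<exists>e\<in>E. x (g + e) \<noteq> p e} B"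
  define H where "H = (+) g ` (E + \<Delta>)"
  have EE: "E \<subseteq> E + \<Delta>" using \<Delta>(2) by (metis add_0_right set_plus_intro subsetI)
  have finH: "finite H" using E \<Delta>(1) by (simp add: H_def finite_set_plus)
  have cardH: "card H = card (E + \<Delta>)" by (simp add: H_def card_image)
  have HB: "H \<subseteq> B" using insert.prems by (simp add: H_def)
  have fin: "finite W" "finite W'" using B by (auto simp: W_def W'_def finite_patterns)
  have sub: "W' \<subseteq> W" by (auto simp: W_def W'_def patterns_def)
  have gE: "(\<lambda>e. g + e) ` E + \<Delta> = H"
    by (force simp: H_def set_plus_def add.assoc)
  \<comment> \<open>By disjointness, overwriting \<open>H\<close> cannot destroy the mismatches at
    the places of \<open>J\<close>.\<close>
  have apart: "h + e \<notin> H" if "h \<in> J" "e \<in> E" for h e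
  proof -
    have "(+) h ` (E + \<Delta>) \<inter> H = {}"
      unfolding H_def using insert.hyps that(1)
      by (intro disjoint_family_onD[OF insert.prems(2)]) auto
    then show ?thesis using that(2) EE by blast
  qed
  have "\<exists>v\<in>W - W'. \<forall>t. t \<notin> H \<longrightarrow> v t = w t" if "w \<in> W" for w
  proof -
    obtain x where x: "x \<in> X" "\<forall>g\<in>J. \<exists>e\<in>E. x (g + e) \<noteq> p e" "w = restrict x B"
      using \<open>w \<in> W\<close> by (auto simp: W_def patterns_def)
    have "shift g p \<in> X" using X p by (simp add: subshift_def)
    then obtain z where z: "z \<in> X" "\<forall>s\<in>(\<lambda>e. g + e) ` E. z s = shift g p s" "\<forall>t. t \<notin> H \<longrightarrow> z t = x t"
      using \<Delta>(3)[of "shift g p" x "(\<lambda>e. g + e) ` E"] x(1) E unfolding gE by auto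
    have "\<forall>h\<in>J. \<exists>e\<in>E. z (h + e) \<noteq> p e" using x(2) z(3) apart by metis
    then have "restrict z B \<in> W" using z(1) by (auto simp: W_def patterns_def)
    \<comment> \<open>The same pattern might come from another configuration \<open>u\<close> with a
      mismatch at \<open>g\<close>; but \<open>g + E\<close> lies in \<open>B\<close>, so
      \<open>u\<close> agrees with \<open>z\<close> there.\<close>
    moreover have "restrict z B \<notin> W'"
    proof
      assume "restrict z B \<in> W'"
      then obtain u e where u: "restrict z B = restrict u B" "e \<in> E" "u (g + e) \<noteq> p e"
        by (auto simp: W'_def patterns_def)
      have "g + e \<in> B" using u(2) EE HB by (auto simp: H_def)
      then have "u (g + e) = z (g + e)" using u(1) by (metis restrict_apply')
      then show False using u z(2) by (simp add: shift_def add.assoc)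
    qed
    moreover have "\<forall>t. t \<notin> H \<longrightarrow> restrict z B t = w t"
      using z(3) x(3) by (simp add: restrict_def)
    ultimately show ?thesis by blast
  qed
  then obtain f where f: "\<And>w. w \<in> W \<Longrightarrow> f w \<in> W - W'"
    "\<And>w t. w \<in> W \<Longrightarrow> t \<notin> H \<Longrightarrow> f w t = w t"
    by metis
  \<comment> \<open>\<open>f w\<close> retains \<open>w\<close> off \<open>H\<close>, so the values
    of \<open>w\<close> on \<open>H\<close> suffice to recover \<open>w\<close>: each element of
    \<open>W - W'\<close> has at most \<open>K\<close> preimages.\<close>
  have "card W \<le> card ((W - W') \<times> (H \<rightarrow>\<^sub>E (UNIV :: 'a set)))"
  proof (rule card_inj_on_le)
    show "inj_on (\<lambda>w. (f w, restrict w H)) W"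
    proof (rule inj_onI)
      fix w w' assume w: "w \<in> W" "w' \<in> W" and eq: "(f w, restrict w H) = (f w', restrict w' H)"
      show "w = w'"
      proof
        fix t show "w t = w' t"
          using eq f(2) w by (cases "t \<in> H") (metis Pair_inject restrict_apply')+
      qed
    qed
    show "(\<lambda>w. (f w, restrict w H)) ` W \<subseteq> (W - W') \<times> (H \<rightarrow>\<^sub>E (UNIV :: 'a set))"
      using f(1) by auto
    show "finite ((W - W') \<times> (H \<rightarrow>\<^sub>E (UNIV :: 'a set)))"
      using fin finH by (simp add: finite_PiE)
  qed
  also have "\<dots> = (card W - card W') * K"
    using fin sub finH by (simp add: card_cartesian_product card_PiE cardH K card_Diff_subset)
  finally have "card W \<le> (card W - card W') * K" .
  moreover have "card W' \<le> card W" using fin sub by (simp add: card_mono)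
  moreover have "K > 0" by (simp add: K)
  \<comment> \<open>A rearrangement of \<open>card W + K * card W' \<le> K * card W\<close>; the
    case split on \<open>K\<close> handles the truncated subtraction.\<close>
  ultimately have step: "K * card W' \<le> (K - 1) * card W"
    by (cases K) (auto simp: algebra_simps elim!: le_Suc_ex[elim_format])
  have IH: "K ^ card J * card W \<le> (K - 1) ^ card J * card (patterns X B)"
    unfolding W_def using insert.IH insert.prems by (simp add: disjoint_family_on_def)
  have "K ^ card J * (K * card W') \<le> K ^ card J * ((K - 1) * card W)"
    using step by (rule mult_left_mono) simp
  also have "\<dots> = (K - 1) * (K ^ card J * card W)" by (rule mult.left_commute)
  also have "\<dots> \<le> (K - 1) * ((K - 1) ^ card J * card (patterns X B))"
    using IH by (rule mult_left_mono) simp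
  finally have "K ^ card J * (K * card W') \<le> (K - 1) * ((K - 1) ^ card J * card (patterns X B))" .
  then show ?case
    unfolding W'_def[symmetric] using insert.hyps by (simp add: ac_simps)
qed

section \<open>Boxes in the integer lattice\<close>

text \<open>Half-open, so that the side is \<open>b - a\<close> and adjacent cubes tile; the cube of
  radius \<open>r\<close> about 0 is \<open>box_int (- r) (r + 1)\<close>.\<close>

definition box_int :: "int \<Rightarrow> int \<Rightarrow> (int ^ 'd::finite) set" where
  "box_int a b = {v. \<forall>i. a \<le> v $ i \<and> v $ i < b}"

lemma
  shows finite_box_int: "finite (box_int a b :: (int ^ 'd::finite) set)"
    and card_box_int: "card (box_int a b :: (int ^ 'd) set) = nat (b - a) ^ CARD('d)"
proof -
  have "bij_betw (($) :: int ^ 'd \<Rightarrow> _) (box_int a b) (UNIV \<rightarrow>\<^sub>E {a..<b})"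
    by (rule bij_betwI[where g = vec_lambda]) (auto simp: box_int_def PiE_iff)
  moreover have "finite ((UNIV :: 'd set) \<rightarrow>\<^sub>E {a..<b})" by (simp add: finite_PiE)
  moreover have "card ((UNIV :: 'd set) \<rightarrow>\<^sub>E {a..<b}) = nat (b - a) ^ CARD('d)"
    by (simp add: card_PiE)
  ultimately show "finite (box_int a b :: (int ^ 'd) set)"
    "card (box_int a b :: (int ^ 'd) set) = nat (b - a) ^ CARD('d)"
    using bij_betw_finite bij_betw_same_card by metis+
qed

lemma box_int_mono: "a' \<le> a \<Longrightarrow> b \<le> b' \<Longrightarrow> box_int a b \<subseteq> box_int a' b'"
  unfolding box_int_def by (rule Collect_mono) (meson order_trans less_le_trans)

lemma box_int_add:
  assumes "u \<in> box_int a b" "v \<in> box_int (- r) (r + 1)"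
  shows "u + v \<in> box_int (a - r) (b + r)"
proof -
  \<comment> \<open>Integrality gives \<open>u $ i \<le> b - 1\<close> and
    \<open>v $ i \<le> r\<close>, hence the strict bound \<open>b + r\<close>.\<close>
  have "a - r \<le> u $ i + v $ i \<and> u $ i + v $ i < b + r" for i
  proof -
    have "a \<le> u $ i" "u $ i < b" "- r \<le> v $ i" "v $ i < r + 1"
      using assms by (auto simp: box_int_def)
    then show ?thesis by linarith
  qed
  then show ?thesis by (simp add: box_int_def)
qed

lemma finite_subset_box_int:
  fixes S :: "(int ^ 'd::finite) set"
  assumes "finite S"
  obtains r :: nat where "S \<subseteq> box_int (- int r) (int r + 1)"
proof -
  \<comment> \<open>A crude common bound, which avoids a maximum over a possibly empty set.\<close>
  define r where "r = (\<Sum>v\<in>S. \<Sum>i\<in>UNIV. nat \<bar>v $ i\<bar>)"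
  have "nat \<bar>v $ i\<bar> \<le> r" if "v \<in> S" for v i
  proof -
    have "nat \<bar>v $ i\<bar> \<le> (\<Sum>i\<in>UNIV. nat \<bar>v $ i\<bar>)" by (rule member_le_sum) auto
    also have "\<dots> \<le> r" unfolding r_def using that assms by (intro member_le_sum) auto
    finally show ?thesis .
  qed
  then have "\<bar>v $ i\<bar> \<le> int r" if "v \<in> S" for v i using that by (simp add: nat_le_iff)
  then have "- int r \<le> v $ i \<and> v $ i < int r + 1" if "v \<in> S" for v i
    by (smt (verit, best) that)
  then have "S \<subseteq> box_int (- int r) (int r + 1)" by (auto simp: box_int_def)
  then show thesis by (rule that)
qed

lemma infinite_UNIV_int_vec: "infinite (UNIV :: (int ^ 'd::finite) set)"
proof
  assume "finite (UNIV :: (int ^ 'd) set)"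
  then obtain r where "(UNIV :: (int ^ 'd) set) \<subseteq> box_int (- int r) (int r + 1)"
    by (rule finite_subset_box_int)
  then have "(\<chi> i. int r + 1) \<in> (box_int (- int r) (int r + 1) :: (int ^ 'd) set)" by blast
  then show False by (simp add: box_int_def)
qed

section \<open>Volume against boundary of cubes\<close>

text \<open>The layer between cubes of sides \<open>l * n\<close> and \<open>l * n + r\<close> is
  small compared with \<open>n ^ d\<close>, so \<open>n ^ d\<close> factors
  \<open>(K - 1) / K\<close> outweigh one factor \<open>a\<close> per point of the layer.\<close>

lemma boundary_negligible:
  fixes l r d K a :: nat
  assumes "K > 0" "a > 0"
  obtains n :: nat where "(K - 1) ^ (n ^ d) * a ^ ((l * n + r) ^ d - (l * n) ^ d) < K ^ (n ^ d)"
proof -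
  \<comment> \<open>Subtracting 1/2 instead of 1 keeps \<open>c\<close> positive even for
    \<open>K = 1\<close>, with \<open>(K - 1) / K < c < 1\<close>.\<close>
  define c where "c = (real K - 1 / 2) / real K"
  have c: "0 < c" "c < 1" using assms by (auto simp: c_def field_simps)
  have "(\<lambda>q. c ^ q * real a) \<longlonglongrightarrow> 0 * real a" using c by (intro tendsto_intros LIMSEQ_power_zero) auto
  then have "\<forall>\<^sub>F q in sequentially. c ^ q * real a < 1" by (rule order_tendstoD) simp
  \<comment> \<open>\<open>q\<close> factors \<open>c\<close> pay for one factor \<open>a\<close>;
    it remains to make the layer smaller than \<open>n ^ d / (q + 1)\<close>.\<close>
  then obtain q where q: "c ^ q * real a < 1" by (auto simp: eventually_sequentially)
  \<comment> \<open>For positive \<open>n\<close> this difference is the size of the layer divided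
    by \<open>n ^ d\<close>.\<close>
  have lim: "(\<lambda>n. (real l + real r * inverse (real n)) ^ d - real l ^ d) \<longlonglongrightarrow> (real l + real r * 0) ^ d - real l ^ d"
    by (intro tendsto_intros lim_inverse_n)
  have "\<forall>\<^sub>F n in sequentially. (real l + real r * inverse (real n)) ^ d - real l ^ d < 1 / (real q + 1)"
    by (rule order_tendstoD(2)[OF lim]) simp
  then have "\<forall>\<^sub>F n in sequentially. n > 0 \<and> (real l + real r * inverse (real n)) ^ d - real l ^ d < 1 / (real q + 1)"
    using eventually_gt_at_top[of 0] by eventually_elim auto
  then obtain n where n: "n > 0" "(real l + real r * inverse (real n)) ^ d - real l ^ d < 1 / (real q + 1)"
    by (auto simp: eventually_sequentially)
  define b where "b = (l * n + r) ^ d - (l * n) ^ d"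
  have "real b = real (l * n + r) ^ d - real (l * n) ^ d"
    unfolding b_def by (subst of_nat_diff) (auto intro: power_mono)
  also have "\<dots> = real n ^ d * ((real l + real r * inverse (real n)) ^ d - real l ^ d)"
  proof -
    have "real (l * n + r) = real n * (real l + real r * inverse (real n))"
      "real (l * n) = real n * real l"
      using n(1) by (simp_all add: field_simps)
    then show ?thesis by (simp only: power_mult_distrib right_diff_distrib)
  qed
  also have "\<dots> < real n ^ d * (1 / (real q + 1))"
    using n by (intro mult_strict_left_mono) auto
  finally have "real b * (real q + 1) < real n ^ d" by (simp add: field_simps)
  then have "real (b * (q + 1)) < real (n ^ d)" by (simp add: algebra_simps)
  then have bq: "b * (q + 1) < n ^ d" by (simp only: of_nat_less_iff)
  \<comment> \<open>Strictness comes from \<open>n ^ d > 0\<close> if the layer is empty, and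
    otherwise from the choice of \<open>q\<close>.\<close>
  have "c ^ (n ^ d) * real a ^ b < 1"
  proof (cases "b = 0")
    case True
    then show ?thesis using c n(1) by (simp add: power_less_one_iff)
  next
    case False
    have "c ^ (n ^ d) * real a ^ b \<le> c ^ (q * b) * real a ^ b"
      using bq c by (intro mult_right_mono power_decreasing) (auto simp: algebra_simps)
    also have "\<dots> = (c ^ q * real a) ^ b" by (simp add: power_mult_distrib power_mult)
    also have "\<dots> < 1" using q c False by (simp add: power_less_one_iff)
    finally show ?thesis .
  qed
  then have "(real K - 1 / 2) ^ (n ^ d) * real a ^ b < real K ^ (n ^ d)"
    using assms by (simp add: c_def power_divide field_simps)
  moreover have "real (K - 1) ^ (n ^ d) * real a ^ b \<le> (real K - 1 / 2) ^ (n ^ d) * real a ^ b"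
    using assms by (intro mult_right_mono power_mono) auto
  ultimately have "real ((K - 1) ^ (n ^ d) * a ^ b) < real (K ^ (n ^ d))" by simp
  then have "(K - 1) ^ (n ^ d) * a ^ b < K ^ (n ^ d)" by (simp only: of_nat_less_iff)
  then show thesis using that unfolding b_def by blast
qed

section \<open>The Myhill property\<close>

lemma pre_injective_imp_surjective:
  fixes X :: "((int ^ 'd::finite) \<Rightarrow> 'a::finite) set"
  assumes X: "subshift X" "closedin prodiscrete X" "strongly_irreducible X"
    and ca: "cellular_automaton X \<tau>" and pre: "pre_injective X \<tau>"
  shows "\<tau> ` X = X"
proof (rule ccontr)
  assume ne: "\<tau> ` X \<noteq> X"
  obtain \<Delta> where \<Delta>: "finite \<Delta>" "0 \<in> \<Delta>"
    "\<And>x y S. x \<in> X \<Longrightarrow> y \<in> X \<Longrightarrow> finite S \<Longrightarrow>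
      \<exists>z\<in>X. (\<forall>s\<in>S. z s = x s) \<and> (\<forall>t. t \<notin> S + \<Delta> \<longrightarrow> z t = y t)"
    using strongly_irreducible_gluing[OF X(2,3)] by blast
  obtain M where M: "finite M"
    "\<And>x y g. x \<in> X \<Longrightarrow> y \<in> X \<Longrightarrow> (\<And>m. m \<in> M \<Longrightarrow> x (g + m) = y (g + m)) \<Longrightarrow> \<tau> x g = \<tau> y g"
    using cellular_automaton_local[OF X(1,2) ca] by metis
  have \<tau>X: "\<tau> ` X \<subseteq> X"
    using ca unfolding cellular_automaton_def continuous_map_def by auto
  then obtain p where p: "p \<in> X" "p \<notin> \<tau> ` X" using ne by blast
  have "openin prodiscrete (UNIV - \<tau> ` X)"
    using closedin_image_cellular_automaton[OF X(2) ca] by (simp add: closedin_def)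
  moreover have "p \<in> UNIV - \<tau> ` X" using p(2) by simp
  ultimately obtain E where E: "finite E" "{x. \<forall>g\<in>E. x g = p g} \<subseteq> UNIV - \<tau> ` X"
    by (rule openin_prodiscrete_cylinder)
  \<comment> \<open>The image is shift invariant, so the pattern of \<open>p\<close> on
    \<open>E\<close>, which never occurs there at the origin, occurs nowhere.\<close>
  have avoid: "\<exists>e\<in>E. y (g + e) \<noteq> p e" if y: "y \<in> \<tau> ` X" for y g
  proof -
    obtain x where x: "x \<in> X" "y = \<tau> x" using y by blast
    have "shift (- g) y = \<tau> (shift (- g) x)" using ca x by (simp add: cellular_automaton_def)
    moreover have "shift (- g) x \<in> X" using X(1) x(1) by (simp add: subshift_def)
    ultimately have "shift (- g) y \<in> \<tau> ` X" by blast
    then have "shift (- g) y \<notin> {x. \<forall>g\<in>E. x g = p g}" using E(2) by blast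
    then show ?thesis by (simp add: shift_def)
  qed
  obtain s where s: "E + \<Delta> \<subseteq> box_int (- int s) (int s + 1)"
    using finite_set_plus[OF E(1) \<Delta>(1)] by (rule finite_subset_box_int)
  obtain r where r: "\<Delta> + uminus ` M \<subseteq> box_int (- int r) (int r + 1)"
    using finite_set_plus[OF \<Delta>(1) finite_imageI[OF M(1)]] by (rule finite_subset_box_int)
  \<comment> \<open>The side of a tile, namely of a cube of radius \<open>s\<close> that holds
    \<open>E + \<Delta>\<close>.\<close>
  define l where "l = 2 * s + 1"
  define K where "K = CARD('a) ^ card (E + \<Delta>)"
  have "K > 0" by (simp add: K_def)
  \<comment> \<open>\<open>B\<close> will consist of \<open>n\<close> tiles in each direction;
    \<open>C\<close> exceeds it by \<open>r\<close> on both sides, hence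
    \<open>2 * r\<close>.\<close>
  then obtain n where n: "(K - 1) ^ (n ^ CARD('d)) *
      CARD('a) ^ ((l * n + 2 * r) ^ CARD('d) - (l * n) ^ CARD('d)) < K ^ (n ^ CARD('d))"
    using boundary_negligible[of K "CARD('a)" "CARD('d)" l "2 * r"] by (auto simp: zero_less_card_finite)
  define B where "B = (box_int 0 (int (l * n)) :: (int ^ 'd) set)"
  define C where "C = (box_int (- int r) (int (l * n) + int r) :: (int ^ 'd) set)"
  \<comment> \<open>The centre of tile \<open>k\<close>: adding \<open>s\<close> makes the tile run
    from \<open>l * k $ i\<close> to just below \<open>l * k $ i + l\<close> in coordinate
    \<open>i\<close>.\<close>
  define j where "j k = (\<chi> i. int l * k $ i + int s)" for k :: "int ^ 'd"
  define J where "J = j ` box_int 0 (int n)"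
  have fin: "finite B" "finite C" by (auto simp: B_def C_def finite_box_int)
  have BC: "B \<subseteq> C" unfolding B_def C_def by (rule box_int_mono) simp_all
  have nbhd: "B + \<Delta> + uminus ` M \<subseteq> C"
  proof -
    have "b + v \<in> C" if "b \<in> B" "v \<in> \<Delta> + uminus ` M" for b v
      using box_int_add[of b 0 "int (l * n)" v "int r"] that r by (auto simp: B_def C_def)
    then have "B + (\<Delta> + uminus ` M) \<subseteq> C" by (auto simp: set_plus_def)
    then show ?thesis by (simp add: add.assoc)
  qed
  have le1: "card (patterns X B) \<le> card (patterns (\<tau> ` X) C)"
    by (rule pre_injective_card_patterns_le[OF pre \<Delta>(1,3) M(2) fin nbhd])
  have tile: "int l * k $ i \<le> (j k + e) $ i \<and> (j k + e) $ i < int l * k $ i + int l"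
    if "e \<in> E + \<Delta>" for k e i
  proof -
    have "- int s \<le> e $ i \<and> e $ i < int s + 1" using that s by (auto simp: box_int_def)
    then show ?thesis by (simp add: j_def l_def)
  qed
  \<comment> \<open>Division by \<open>l\<close> reads the index of the tile off any of its points,
    which makes the tiles disjoint.\<close>
  have tile_div: "(j k + e) $ i div int l = k $ i" if "e \<in> E + \<Delta>" for k e i
  proof (rule int_div_pos_eq)
    show "(j k + e) $ i = int l * k $ i + ((j k + e) $ i - int l * k $ i)" by simp
  qed (use tile[OF that, of k i] in auto)
  have J1: "(+) g ` (E + \<Delta>) \<subseteq> B" if g: "g \<in> J" for g
  proof -
    obtain k where k: "g = j k" "k \<in> box_int 0 (int n)" using g by (auto simp: J_def)
    have "0 \<le> (j k + e) $ i \<and> (j k + e) $ i < int (l * n)" if "e \<in> E + \<Delta>" for e i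
    proof -
      have "0 \<le> k $ i" "k $ i < int n" using k(2) by (auto simp: box_int_def)
      then have ki: "0 \<le> k $ i" "k $ i + 1 \<le> int n" by auto
      have "0 \<le> int l * k $ i" using ki by simp
      moreover have "int l * (k $ i + 1) \<le> int l * int n" using ki by (intro mult_left_mono) auto
      ultimately show ?thesis using tile[OF that, of k i] by (simp add: algebra_simps)
    qed
    then show ?thesis unfolding k(1) B_def box_int_def by auto
  qed
  have J2: "disjoint_family_on (\<lambda>g. (+) g ` (E + \<Delta>)) J"
    unfolding disjoint_family_on_def
  proof (intro ballI impI, rule ccontr)
    fix g h assume gh: "g \<in> J" "h \<in> J" "g \<noteq> h" "(+) g ` (E + \<Delta>) \<inter> (+) h ` (E + \<Delta>) \<noteq> {}"
    then obtain k k' where k: "g = j k" "h = j k'" by (auto simp: J_def)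
    obtain e e' where e: "e \<in> E + \<Delta>" "e' \<in> E + \<Delta>" "j k + e = j k' + e'"
      using gh(4) k by auto
    have "k $ i = k' $ i" for i using tile_div e by metis
    then have "k = k'" by (simp add: vec_eq_iff)
    then show False using gh(3) k by simp
  qed
  have "inj j" by (rule injI) (simp add: j_def l_def vec_eq_iff)
  then have "inj_on j (box_int 0 (int n))" by (rule inj_on_subset) simp
  then have cardJ: "card J = n ^ CARD('d)" by (simp add: J_def card_image card_box_int)
  have finJ: "finite J" by (simp add: J_def finite_box_int)
  have "nat (int (l * n) + int r - - int r) = l * n + 2 * r" by linarith
  then have cardCB: "card (C - B) = (l * n + 2 * r) ^ CARD('d) - (l * n) ^ CARD('d)"
    using card_Diff_subset[OF fin(1) BC] by (simp only: B_def C_def card_box_int nat_int diff_0_right)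
  have avoid_le: "card (patterns (\<tau> ` X) B)
      \<le> card (patterns {x\<in>X. \<forall>g\<in>J. \<exists>e\<in>E. x (g + e) \<noteq> p e} B)"
  proof (rule card_mono)
    show "finite (patterns {x\<in>X. \<forall>g\<in>J. \<exists>e\<in>E. x (g + e) \<noteq> p e} B)"
      using fin(1) by (rule finite_patterns)
    have "\<tau> ` X \<subseteq> {x\<in>X. \<forall>g\<in>J. \<exists>e\<in>E. x (g + e) \<noteq> p e}" using avoid \<tau>X by blast
    then show "patterns (\<tau> ` X) B \<subseteq> patterns {x\<in>X. \<forall>g\<in>J. \<exists>e\<in>E. x (g + e) \<noteq> p e} B"
      unfolding patterns_def by (rule image_mono)
  qed
  define N where "N = n ^ CARD('d)"
  define P where "P = card (patterns (\<tau> ` X) B)"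
  \<comment> \<open>The counts close up: avoidance at \<open>N\<close> places bounds
    \<open>P\<close> by the patterns of \<open>X\<close> on \<open>B\<close>, and pre-injectivity
    bounds these by \<open>P\<close> times the boundary factor.\<close>
  have "K ^ N * P \<le> K ^ N * card (patterns {x\<in>X. \<forall>g\<in>J. \<exists>e\<in>E. x (g + e) \<noteq> p e} B)"
    unfolding P_def using avoid_le by (rule mult_left_mono) simp
  also have "\<dots> \<le> (K - 1) ^ N * card (patterns X B)"
    unfolding N_def cardJ[symmetric]
    by (rule card_patterns_avoiding[OF X(1) \<Delta>(1,2,3) p(1) E(1) fin(1) finJ J1 J2 K_def])
  also have "\<dots> \<le> (K - 1) ^ N * (P * CARD('a) ^ card (C - B))"
    unfolding P_def using le1 card_patterns_mono[OF fin(2) BC, of "\<tau> ` X"]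
    by (intro mult_left_mono) auto
  finally have "K ^ N * P \<le> ((K - 1) ^ N * CARD('a) ^ card (C - B)) * P"
    by (simp add: ac_simps)
  \<comment> \<open>\<open>p\<close> shows that \<open>X\<close> is nonempty, so \<open>P\<close>
    cancels and the choice of \<open>n\<close> is contradicted.\<close>
  moreover have "P > 0"
    unfolding P_def card_gt_0_iff using p(1) finite_patterns[OF fin(1)] by (auto simp: patterns_def)
  ultimately have "K ^ N \<le> (K - 1) ^ N * CARD('a) ^ card (C - B)" by simp
  then show False using n unfolding N_def cardCB by simp
qed

theorem theorem4:
  fixes X :: "((int ^ 'd::finite) \<Rightarrow> 'a::finite) set"
    and \<tau> :: "((int ^ 'd) \<Rightarrow> 'a) \<Rightarrow> ((int ^ 'd) \<Rightarrow> 'a)"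
  assumes "subshift X"
    and "closedin prodiscrete X"
    and "strongly_irreducible X"
    and "finite_type X"
    and "\<exists>x\<in>X. periodic x"
    and "cellular_automaton X \<tau>"
    and "\<exists>U. openin (subtopology prodiscrete X) U \<and> U \<noteq> {} \<and> inj_on \<tau> U"
  shows "\<tau> ` X = X \<and> pre_injective X \<tau>"
proof -
  obtain U where "openin (subtopology prodiscrete X) U" "U \<noteq> {}" "inj_on \<tau> U"
    using assms(7) by blast
  then have "pre_injective X \<tau>"
    by (rule locally_injective_imp_pre_injective[OF infinite_UNIV_int_vec assms(1-4,6)])
  then show ?thesis
    using pre_injective_imp_surjective[OF assms(1-3,6)] by blast
qed

end
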